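(* Let $\mathcal X=\{(X_\alpha,d_\alpha)\}_{\alpha\in I}$ be a family of metric spaces. Then \[ \operatorname{asdim}(\mathcal X)=\sup_{J}\operatorname{asdim}\big(\{(X_\alpha,d_\alpha)\}_{\alpha\in J}\big), \] where the supremum is over all countable subsets $J\subset I$.
   Context: A family of metric spaces $\{X_\alpha\}_\alpha$ has $\operatorname{asdim}\le n$ (uniformly) if for every $R>0$ there is $S>0$ such that every $X_\alpha$ has a cover $\mathcal U^\alpha$ by sets of diameter at most $S$, with multiplicity at most $n+1$ (any $n+2$ distinct members have empty intersection) and Lebesgue number at least $R$ (every non-empty subset of $X_\alpha$ of diameter at most $R$ lies in some member of $\mathcal U^\alpha$). The value $\operatorname{asdim}\in\{0,1,2,\dots\}\cup\{\infty\}$ is the least such $n$, or $\infty$ if there is none. *)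

theory Defs
  imports "HOL-Analysis.Abstract_Metric_Spaces" "HOL-Library.Extended_Nat" "HOL-Library.Countable_Set"
    "HOL-Library.Extended_Nonnegative_Real"
begin

text \<open>The diameter takes values in the extended non-negative reals, so that unbounded sets have
  diameter \<open>\<infinity>\<close> and the empty set has diameter \<open>0\<close>.\<close>

definition mdiameter :: "('a \<Rightarrow> 'a \<Rightarrow> real) \<Rightarrow> 'a set \<Rightarrow> ennreal" where
  "mdiameter d A = (SUP x\<in>A. SUP y\<in>A. ennreal (d x y))"

definition is_cover :: "'a set \<Rightarrow> 'a set set \<Rightarrow> bool" where
  "is_cover X \<U> \<longleftrightarrow> (\<forall>U\<in>\<U>. U \<subseteq> X) \<and> \<Union>\<U> = X"

definition multiplicity_at_most :: "'a set set \<Rightarrow> nat \<Rightarrow> bool" where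
  "multiplicity_at_most \<U> m \<longleftrightarrow> (\<forall>\<V>\<subseteq>\<U>. finite \<V> \<and> card \<V> = m + 1 \<longrightarrow> \<Inter>\<V> = {})"

definition lebesgue_number_at_least ::
    "'a set \<Rightarrow> ('a \<Rightarrow> 'a \<Rightarrow> real) \<Rightarrow> 'a set set \<Rightarrow> real \<Rightarrow> bool" where
  "lebesgue_number_at_least X d \<U> R \<longleftrightarrow>
     (\<forall>A\<subseteq>X. A \<noteq> {} \<and> mdiameter d A \<le> ennreal R \<longrightarrow> (\<exists>U\<in>\<U>. A \<subseteq> U))"

text \<open>A family of metric spaces is given by an index set \<open>I\<close>, carriers \<open>X \<alpha>\<close> inside a common type
  and metrics \<open>d \<alpha>\<close>. The carriers need not be disjoint, and the metrics on different members are
  unrelated.\<close>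

definition asdim_le ::
    "'i set \<Rightarrow> ('i \<Rightarrow> 'a set) \<Rightarrow> ('i \<Rightarrow> 'a \<Rightarrow> 'a \<Rightarrow> real) \<Rightarrow> nat \<Rightarrow> bool" where
  "asdim_le I X d n \<longleftrightarrow>
     (\<forall>R>0. \<exists>S>0. \<forall>\<alpha>\<in>I. \<exists>\<U>.
        is_cover (X \<alpha>) \<U> \<and>
        (\<forall>U\<in>\<U>. mdiameter (d \<alpha>) U \<le> ennreal S) \<and>
        multiplicity_at_most \<U> (n + 1) \<and>
        lebesgue_number_at_least (X \<alpha>) (d \<alpha>) \<U> R)"

text \<open>The infimum of the empty set in \<^typ>\<open>enat\<close> is \<open>\<infinity>\<close>; a nonempty set of naturals attains its
  infimum.\<close>

definition asdim ::
    "'i set \<Rightarrow> ('i \<Rightarrow> 'a set) \<Rightarrow> ('i \<Rightarrow> 'a \<Rightarrow> 'a \<Rightarrow> real) \<Rightarrow> enat" where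
  "asdim I X d = Inf {enat n | n. asdim_le I X d n}"

end

theory Submission imports Defs begin

text \<open>A failure of the bound \<open>n\<close> over \<open>I\<close> at some scale \<open>R\<close> is witnessed by one index for each
  integer value of \<open>S\<close>; these countably many indices form a subfamily for which the bound already
  fails.\<close>

lemma multiplicity_at_most_mono:
  assumes "multiplicity_at_most \<U> m" "m \<le> m'"
  shows "multiplicity_at_most \<U> m'"
  unfolding multiplicity_at_most_def
proof (intro allI impI)
  fix \<V> assume \<V>: "\<V> \<subseteq> \<U>" "finite \<V> \<and> card \<V> = m' + 1"
  then obtain \<W> where "\<W> \<subseteq> \<V>" "card \<W> = m + 1" "finite \<W>"
    using \<open>m \<le> m'\<close> by (metis add_le_mono1 obtain_subset_with_card_n)
  with \<V> assms(1) show "\<Inter>\<V> = {}"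
    unfolding multiplicity_at_most_def by (metis Inter_anti_mono subset_empty subset_trans)
qed

lemma asdim_le_mono:
  fixes X :: "'i \<Rightarrow> 'a set"
  assumes "asdim_le I X d m" "m \<le> n"
  shows "asdim_le I X d n"
proof -
  have "multiplicity_at_most \<U> (n + 1)" if "multiplicity_at_most \<U> (m + 1)" for \<U> :: "'a set set"
    using multiplicity_at_most_mono[OF that] \<open>m \<le> n\<close> by simp
  with assms(1) show ?thesis
    unfolding asdim_le_def by fast
qed

lemma asdim_le_subset:
  assumes "asdim_le I X d n" "J \<subseteq> I"
  shows "asdim_le J X d n"
  using assms unfolding asdim_le_def by fast

lemma asdim_le_enat_iff: "asdim I X d \<le> enat n \<longleftrightarrow> asdim_le I X d n"
proof
  assume le: "asdim I X d \<le> enat n"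
  let ?A = "{enat n | n. asdim_le I X d n}"
  have "?A \<noteq> {}"
    using le unfolding asdim_def by (auto simp: Inf_enat_def split: if_splits)
  then have "Inf ?A \<in> ?A"
    by (metis (mono_tags, lifting) Inf_enat_def LeastI_ex ex_in_conv)
  then obtain m where "Inf ?A = enat m" "asdim_le I X d m"
    by blast
  with le show "asdim_le I X d n"
    unfolding asdim_def by (auto intro: asdim_le_mono)
next
  assume "asdim_le I X d n"
  then show "asdim I X d \<le> enat n"
    unfolding asdim_def by (auto intro: Inf_lower)
qed

lemma asdim_le_countable:
  assumes countable_le: "\<And>J. J \<subseteq> I \<Longrightarrow> countable J \<Longrightarrow> asdim_le J X d n"
  shows "asdim_le I X d n"
proof -
  define good where "good R S \<alpha> \<longleftrightarrow> (\<exists>\<U>. is_cover (X \<alpha>) \<U> \<and>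
      (\<forall>U\<in>\<U>. mdiameter (d \<alpha>) U \<le> ennreal S) \<and> multiplicity_at_most \<U> (n + 1) \<and>
      lebesgue_number_at_least (X \<alpha>) (d \<alpha>) \<U> R)" for R S \<alpha>
  have asdim_le_iff: "asdim_le J X d n \<longleftrightarrow> (\<forall>R>0. \<exists>S>0. \<forall>\<alpha>\<in>J. good R S \<alpha>)" for J
    unfolding asdim_le_def good_def ..
  have good_mono: "good R S' \<alpha>" if "good R S \<alpha>" "S \<le> S'" for R S S' \<alpha>
    using that unfolding good_def by (meson ennreal_leI order_trans)
  show ?thesis
  proof (rule ccontr)
    assume "\<not> asdim_le I X d n"
    then obtain R where "R > 0" and fails: "\<And>S. S > 0 \<Longrightarrow> \<exists>\<alpha>\<in>I. \<not> good R S \<alpha>"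
      unfolding asdim_le_iff by blast
    have "\<forall>k. \<exists>\<alpha>\<in>I. \<not> good R (real (Suc k)) \<alpha>"
      using fails by simp
    then obtain a where a: "\<And>k. a k \<in> I" "\<And>k. \<not> good R (real (Suc k)) (a k)"
      by metis
    have "asdim_le (range a) X d n"
      using a(1) by (intro countable_le) auto
    then obtain S where S: "\<And>k. good R S (a k)"
      using \<open>R > 0\<close> unfolding asdim_le_iff by blast
    obtain k where "S \<le> real k"
      using real_arch_simple by blast
    then show False
      using a(2) good_mono[OF S, of "real (Suc k)" k] by simp
  qed
qed

theorem lemma2p2:
  fixes I :: "'i set"
    and X :: "'i \<Rightarrow> 'a set"
    and d :: "'i \<Rightarrow> 'a \<Rightarrow> 'a \<Rightarrow> real"
  assumes "\<And>\<alpha>. \<alpha> \<in> I \<Longrightarrow> Metric_space (X \<alpha>) (d \<alpha>)"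
  shows "asdim I X d = (SUP J\<in>{J. J \<subseteq> I \<and> countable J}. asdim J X d)"
proof (rule antisym)
  show "asdim I X d \<le> (SUP J\<in>{J. J \<subseteq> I \<and> countable J}. asdim J X d)" (is "_ \<le> ?s")
  proof (cases ?s)
    case (enat n)
    have "asdim_le J X d n" if "J \<subseteq> I" "countable J" for J
      using that enat SUP_upper[of J "{J. J \<subseteq> I \<and> countable J}" "\<lambda>J. asdim J X d"]
      by (simp add: asdim_le_enat_iff)
    then show ?thesis
      unfolding enat asdim_le_enat_iff by (rule asdim_le_countable)
  next
    case infinity
    then show ?thesis by simp
  qed
next
  have "asdim J X d \<le> asdim I X d" if "J \<subseteq> I" for J
  proof (cases "asdim I X d")
    case (enat n)
    then have "asdim_le I X d n"
      by (simp flip: asdim_le_enat_iff)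
    then show ?thesis
      unfolding enat asdim_le_enat_iff using that by (rule asdim_le_subset)
  qed simp
  then show "(SUP J\<in>{J. J \<subseteq> I \<and> countable J}. asdim J X d) \<le> asdim I X d"
    by (auto intro: SUP_least)
qed

end
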